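(* Let $K$ be an algebraically closed non-archimedean field with valuation $v$, valuation ring $R$ and residue field $k$ with $\mathrm{char}(k)\neq2,3$. Let $E/K$ be an elliptic curve with $v(j(E))<0$, let $W$ be a minimal Weierstrass model of $E$ of the form $$y^2=x^3+a(x-b)^2,\qquad a,b\in R,$$ and let $P\in E[3](K)$ be a point that reduces to the singular point of the reduced curve $\overline{E}$ of $W$ and satisfies $x(P)=0$. Then $v(a)=0$ and $v(b)>0$.
   Context: $v:K^*\to\mathbb{R}$ is extended by $v(0)=\infty$; $R=\{z\in K: v(z)\ge0\}$, $\mathfrak{m}$ is its maximal ideal and $k=R/\mathfrak{m}$. An integral Weierstrass equation for $E$ is a Weierstrass equation $y^2+a_1xy+a_3y=x^3+a_2x^2+a_4x+a_6$ of $E$ with all $a_i\in R$. It is minimal (a minimal Weierstrass model) if the valuation $v(\Delta)$ of its discriminant is minimal among all integral Weierstrass equations for $E$. The reduced curve $\overline{E}/k$ is defined by reducing the $a_i$ modulo $\mathfrak{m}$. The reduction $\overline{P}\in\overline{E}(k)$ of $P\in E(K)$ is obtained by scaling projective coordinates $[x_0,y_0,z_0]$ of $P$ so that they lie in $R$ and at least one is a unit, and then reducing modulo $\mathfrak{m}$. When $v(j(E))<0$, the reduced curve $\overline{E}$ of a minimal model has a unique singular point, which is a node. $E[3](K)$ is the group of points $P\in E(K)$ with $3P=\mathcal{O}$, where $\mathcal{O}$ is the point at infinity. *)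

theory Defs
  imports
    "HOL-Library.Extended_Real"
    "HOL-Computational_Algebra.Polynomial"
    "HOL-Algebra.QuotRing"
    "HOL-Algebra.Multiplicative_Group"
    "HOL-Algebra.Algebraic_Closure_Type"
begin

section \<open>Valued fields\<close>

locale nonarch_valuation =
  fixes v :: "'a::field \<Rightarrow> ereal"
  assumes v_zero: "v 0 = \<infinity>"
    and v_finite: "x \<noteq> 0 \<Longrightarrow> \<bar>v x\<bar> \<noteq> \<infinity>"
    and v_mult: "v (x * y) = v x + v y"
    and v_add: "min (v x) (v y) \<le> v (x + y)"

definition valuation_ring :: "('a::field \<Rightarrow> ereal) \<Rightarrow> 'a ring"
  where "valuation_ring v = ring_of_type_algebra \<lparr> carrier := {z. 0 \<le> v z} \<rparr>"

definition valuation_ideal :: "('a::field \<Rightarrow> ereal) \<Rightarrow> 'a set"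
  where "valuation_ideal v = {z. 0 < v z}"

definition residue_field :: "('a::field \<Rightarrow> ereal) \<Rightarrow> 'a set ring"
  where "residue_field v = valuation_ring v Quot valuation_ideal v"

definition residue :: "('a::field \<Rightarrow> ereal) \<Rightarrow> 'a \<Rightarrow> 'a set"
  where "residue v z = valuation_ideal v +>\<^bsub>valuation_ring v\<^esub> z"

text \<open>The library's \<^const>\<open>group.ord\<close> is 0 on elements of infinite order, so this is 0 in
  characteristic zero.\<close>

definition ring_char :: "('b, 'm) ring_scheme \<Rightarrow> nat"
  where "ring_char R = group.ord (add_monoid R) \<one>\<^bsub>R\<^esub>"

context nonarch_valuation
begin

lemma v_one: "v 1 = 0"
proof -
  have "v 1 = v 1 + v 1"
    using v_mult[of 1 1] by simp
  then show ?thesis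
    using v_finite[of 1] by (cases "v 1") auto
qed

lemma v_minus_one: "v (-1) = 0"
proof -
  have "v (-1) + v (-1) = 0"
    using v_mult[of "-1" "-1"] v_one by simp
  then show ?thesis
    using v_finite[of "-1"] by (cases "v (-1)") auto
qed

lemma v_minus: "v (- x) = v x"
  using v_mult[of "-1" x] v_minus_one by simp

lemma cring_valuation_ring: "cring (valuation_ring v)"
proof (rule cringI)
  show "abelian_group (valuation_ring v)"
  proof (rule abelian_groupI)
    fix x y assume "x \<in> carrier (valuation_ring v)" "y \<in> carrier (valuation_ring v)"
    then show "x \<oplus>\<^bsub>valuation_ring v\<^esub> y \<in> carrier (valuation_ring v)"
      using v_add[of x y]
      by (auto simp: valuation_ring_def ring_of_type_algebra_def min_def split: if_splits)
  next
    fix x assume "x \<in> carrier (valuation_ring v)"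
    then show "\<exists>y\<in>carrier (valuation_ring v). y \<oplus>\<^bsub>valuation_ring v\<^esub> x = \<zero>\<^bsub>valuation_ring v\<^esub>"
      by (intro bexI[of _ "- x"]) (auto simp: valuation_ring_def ring_of_type_algebra_def v_minus)
  qed (auto simp: valuation_ring_def ring_of_type_algebra_def v_zero)
  show "comm_monoid (valuation_ring v)"
    by (rule comm_monoidI)
      (auto simp: valuation_ring_def ring_of_type_algebra_def v_one v_mult mult_ac)
qed (auto simp: valuation_ring_def ring_of_type_algebra_def algebra_simps)

lemma maximalideal_valuation_ideal: "maximalideal (valuation_ideal v) (valuation_ring v)"
proof -
  interpret R: cring "valuation_ring v" by (rule cring_valuation_ring)
  have idl: "ideal (valuation_ideal v) (valuation_ring v)"
  proof (rule idealI[OF R.ring_axioms])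
    show "subgroup (valuation_ideal v) (add_monoid (valuation_ring v))"
    proof (rule group.subgroupI)
      show "group (add_monoid (valuation_ring v))"
        by (rule R.a_group)
      show "valuation_ideal v \<noteq> {}"
        using v_zero by (auto simp: valuation_ideal_def intro!: exI[of _ 0])
    next
      fix x assume x: "x \<in> valuation_ideal v"
      then have "inv\<^bsub>add_monoid (valuation_ring v)\<^esub> x = - x"
        by (intro group.inv_equality[OF R.a_group])
          (auto simp: valuation_ring_def ring_of_type_algebra_def valuation_ideal_def v_minus)
      then show "inv\<^bsub>add_monoid (valuation_ring v)\<^esub> x \<in> valuation_ideal v"
        using x by (simp add: valuation_ideal_def v_minus)
    next
      fix x y assume "x \<in> valuation_ideal v" "y \<in> valuation_ideal v"
      then show "x \<otimes>\<^bsub>add_monoid (valuation_ring v)\<^esub> y \<in> valuation_ideal v"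
        using v_add[of x y]
        by (auto simp: valuation_ring_def ring_of_type_algebra_def valuation_ideal_def min_def
            split: if_splits)
    qed (auto simp: valuation_ring_def ring_of_type_algebra_def valuation_ideal_def)
  qed (auto simp: valuation_ring_def ring_of_type_algebra_def valuation_ideal_def
      v_mult add_pos_nonneg add_nonneg_pos)
  show ?thesis
  proof (rule maximalidealI[OF idl])
    show "carrier (valuation_ring v) \<noteq> valuation_ideal v"
      using v_one
      by (auto simp: valuation_ring_def ring_of_type_algebra_def valuation_ideal_def set_eq_iff
          intro!: exI[of _ 1])
  next
    fix J assume J: "ideal J (valuation_ring v)" and sub: "valuation_ideal v \<subseteq> J"
      and JR: "J \<subseteq> carrier (valuation_ring v)"
    show "J = valuation_ideal v \<or> J = carrier (valuation_ring v)"
    proof (rule disjCI)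
      assume "J \<noteq> carrier (valuation_ring v)"
      then have one: "1 \<notin> J"
        using ideal.one_imp_carrier[OF J] by (auto simp: valuation_ring_def ring_of_type_algebra_def)
      have "x \<in> valuation_ideal v" if x: "x \<in> J" for x
      proof (rule ccontr)
        assume "x \<notin> valuation_ideal v"
        then have vx: "v x = 0"
          using x JR by (auto simp: valuation_ideal_def valuation_ring_def ring_of_type_algebra_def)
        then have nz: "x \<noteq> 0" using v_zero by auto
        have "v x + v (inverse x) = 0"
          using v_mult[of x "inverse x"] nz v_one by simp
        then have "v (inverse x) = 0" using vx by simp
        then have "inverse x \<otimes>\<^bsub>valuation_ring v\<^esub> x \<in> J"
          using ideal.I_l_closed[OF J x, of "inverse x"]
          by (simp add: valuation_ring_def ring_of_type_algebra_def)
        then show False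
          using nz one by (simp add: valuation_ring_def ring_of_type_algebra_def)
      qed
      then show "J = valuation_ideal v"
        using sub by auto
    qed
  qed
qed

lemma field_residue_field: "field (residue_field v)"
  unfolding residue_field_def
  by (rule maximalideal.quotient_is_field[OF maximalideal_valuation_ideal cring_valuation_ring])

end


section \<open>Weierstrass equations\<close>

text \<open>\<open>Weierstrass a\<^sub>1 a\<^sub>2 a\<^sub>3 a\<^sub>4 a\<^sub>6\<close> stands for
  \<open>y\<^sup>2 + a\<^sub>1 x y + a\<^sub>3 y = x\<^sup>3 + a\<^sub>2 x\<^sup>2 + a\<^sub>4 x + a\<^sub>6\<close>.\<close>

datatype 'a weierstrass = Weierstrass 'a 'a 'a 'a 'a

fun b_invariants :: "'a::field weierstrass \<Rightarrow> 'a \<times> 'a \<times> 'a \<times> 'a"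
  where "b_invariants (Weierstrass a1 a2 a3 a4 a6) =
    (a1^2 + 4 * a2,
     2 * a4 + a1 * a3,
     a3^2 + 4 * a6,
     a1^2 * a6 + 4 * a2 * a6 - a1 * a3 * a4 + a2 * a3^2 - a4^2)"

definition c4_invariant :: "'a::field weierstrass \<Rightarrow> 'a"
  where "c4_invariant E = (case b_invariants E of (b2, b4, b6, b8) \<Rightarrow> b2^2 - 24 * b4)"

definition discriminant :: "'a::field weierstrass \<Rightarrow> 'a"
  where "discriminant E = (case b_invariants E of (b2, b4, b6, b8) \<Rightarrow>
    - (b2^2 * b8) - 8 * b4^3 - 27 * b6^2 + 9 * b2 * b4 * b6)"

definition elliptic_curve :: "'a::field weierstrass \<Rightarrow> bool"
  where "elliptic_curve E \<longleftrightarrow> discriminant E \<noteq> 0"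

definition j_invariant :: "'a::field weierstrass \<Rightarrow> 'a"
  where "j_invariant E = c4_invariant E ^ 3 / discriminant E"


subsection \<open>Points and the group law\<close>

datatype 'a point = Infinity | Affine 'a 'a

fun on_curve :: "'a::field weierstrass \<Rightarrow> 'a point \<Rightarrow> bool"
  where
    "on_curve E Infinity \<longleftrightarrow> True"
  | "on_curve (Weierstrass a1 a2 a3 a4 a6) (Affine x y) \<longleftrightarrow>
      y^2 + a1 * x * y + a3 * y = x^3 + a2 * x^2 + a4 * x + a6"

text \<open>The chord-tangent law. The second case is that of opposite points; otherwise \<open>l\<close> is the slope
  of the chord, or of the tangent when the two points coincide.\<close>

fun add_point :: "'a::field weierstrass \<Rightarrow> 'a point \<Rightarrow> 'a point \<Rightarrow> 'a point"
  where
    "add_point E Infinity Q = Q"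
  | "add_point E P Infinity = P"
  | "add_point (Weierstrass a1 a2 a3 a4 a6) (Affine x1 y1) (Affine x2 y2) =
      (if x1 = x2 \<and> y1 + y2 + a1 * x2 + a3 = 0 then Infinity
       else
         let l = (if x1 \<noteq> x2 then (y2 - y1) / (x2 - x1)
                  else (3 * x1^2 + 2 * a2 * x1 + a4 - a1 * y1) / (2 * y1 + a1 * x1 + a3));
             x3 = l^2 + a1 * l - a2 - x1 - x2
         in Affine x3 (- (l + a1) * x3 - (y1 - l * x1) - a3))"

primrec mult_point :: "'a::field weierstrass \<Rightarrow> nat \<Rightarrow> 'a point \<Rightarrow> 'a point"
  where
    "mult_point E 0 P = Infinity"
  | "mult_point E (Suc n) P = add_point E P (mult_point E n P)"

definition torsion :: "'a::field weierstrass \<Rightarrow> nat \<Rightarrow> 'a point set"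
  where "torsion E n = {P. on_curve E P \<and> mult_point E n P = Infinity}"


subsection \<open>Weierstrass equations of a given curve\<close>

text \<open>The admissible change of coordinates \<open>x = u\<^sup>2 x' + r\<close>, \<open>y = u\<^sup>3 y' + s u\<^sup>2 x' + t\<close>, with
  \<open>u \<noteq> 0\<close>: its effect on the equation and on the points. The Weierstrass equations of a curve
  are those obtained from a given one by such a change.\<close>

fun change_equation :: "'a::field \<Rightarrow> 'a \<Rightarrow> 'a \<Rightarrow> 'a \<Rightarrow> 'a weierstrass \<Rightarrow> 'a weierstrass"
  where "change_equation u r s t (Weierstrass a1 a2 a3 a4 a6) = Weierstrass
    ((a1 + 2 * s) / u)
    ((a2 - s * a1 + 3 * r - s^2) / u^2)
    ((a3 + r * a1 + 2 * t) / u^3)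
    ((a4 - s * a3 + 2 * r * a2 - (t + r * s) * a1 + 3 * r^2 - 2 * s * t) / u^4)
    ((a6 + r * a4 + r^2 * a2 + r^3 - t * a3 - t^2 - r * t * a1) / u^6)"

fun change_point :: "'a::field \<Rightarrow> 'a \<Rightarrow> 'a \<Rightarrow> 'a \<Rightarrow> 'a point \<Rightarrow> 'a point"
  where
    "change_point u r s t Infinity = Infinity"
  | "change_point u r s t (Affine x y) = Affine ((x - r) / u^2) ((y - s * (x - r) - t) / u^3)"

lemma on_curve_change_point:
  assumes "u \<noteq> 0"
  shows "on_curve (change_equation u r s t E) (change_point u r s t P) \<longleftrightarrow> on_curve E P"
proof (cases E, cases P)
  fix a1 a2 a3 a4 a6 x y
  assume E: "E = Weierstrass a1 a2 a3 a4 a6" and P: "P = Affine x y"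
  define x' and y' where "x' = (x - r) / u^2" and "y' = (y - s * (x - r) - t) / u^3"
  have x: "x = u^2 * x' + r" and y: "y = u^3 * y' + s * u^2 * x' + t"
    using assms by (simp_all add: x'_def y'_def field_simps)
  define A1 and A2 and A3 and A4 and A6 where
    "A1 = (a1 + 2 * s) / u" and "A2 = (a2 - s * a1 + 3 * r - s^2) / u^2" and
    "A3 = (a3 + r * a1 + 2 * t) / u^3" and
    "A4 = (a4 - s * a3 + 2 * r * a2 - (t + r * s) * a1 + 3 * r^2 - 2 * s * t) / u^4" and
    "A6 = (a6 + r * a4 + r^2 * a2 + r^3 - t * a3 - t^2 - r * t * a1) / u^6"
  have a: "a1 = u * A1 - 2 * s" "a2 = u^2 * A2 + s * a1 - 3 * r + s^2"
    "a3 = u^3 * A3 - r * a1 - 2 * t"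
    "a4 = u^4 * A4 + s * a3 - 2 * r * a2 + (t + r * s) * a1 - 3 * r^2 + 2 * s * t"
    "a6 = u^6 * A6 - r * a4 - r^2 * a2 - r^3 + t * a3 + t^2 + r * t * a1"
    using assms by (simp_all add: A1_def A2_def A3_def A4_def A6_def)
  have "y^2 + a1 * x * y + a3 * y - (x^3 + a2 * x^2 + a4 * x + a6) =
      u^6 * (y'^2 + A1 * x' * y' + A3 * y' - (x'^3 + A2 * x'^2 + A4 * x' + A6))"
    unfolding x y a
    by (simp add: algebra_simps eval_nat_numeral)
  then show ?thesis
    using assms E P
    by (simp flip: x'_def y'_def A1_def A2_def A3_def A4_def A6_def) (metis eq_iff_diff_eq_0 mult_eq_0_iff power_not_zero)
qed auto

definition weierstrass_equation_of :: "'a::field weierstrass \<Rightarrow> 'a weierstrass \<Rightarrow> bool"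
  where "weierstrass_equation_of E W \<longleftrightarrow> (\<exists>u r s t. u \<noteq> 0 \<and> W = change_equation u r s t E)"

definition integral_equation :: "('a::field \<Rightarrow> ereal) \<Rightarrow> 'a weierstrass \<Rightarrow> bool"
  where "integral_equation v W \<longleftrightarrow> set_weierstrass W \<subseteq> carrier (valuation_ring v)"

definition minimal_model :: "('a::field \<Rightarrow> ereal) \<Rightarrow> 'a weierstrass \<Rightarrow> 'a weierstrass \<Rightarrow> bool"
  where "minimal_model v E W \<longleftrightarrow>
    weierstrass_equation_of E W \<and> integral_equation v W \<and>
    (\<forall>W'. weierstrass_equation_of E W' \<and> integral_equation v W'
       \<longrightarrow> v (discriminant W) \<le> v (discriminant W'))"


section \<open>Reduction\<close>

text \<open>A point of the projective plane is the set of all its homogeneous coordinate triples.\<close>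

fun proj_class :: "('b, 'm) ring_scheme \<Rightarrow> 'b \<times> 'b \<times> 'b \<Rightarrow> ('b \<times> 'b \<times> 'b) set"
  where "proj_class F (x, y, z) =
    (\<lambda>c. (c \<otimes>\<^bsub>F\<^esub> x, c \<otimes>\<^bsub>F\<^esub> y, c \<otimes>\<^bsub>F\<^esub> z)) ` (carrier F - {\<zero>\<^bsub>F\<^esub>})"

definition proj_plane :: "('b, 'm) ring_scheme \<Rightarrow> ('b \<times> 'b \<times> 'b) set set"
  where "proj_plane F = proj_class F `
    (carrier F \<times> carrier F \<times> carrier F - {(\<zero>\<^bsub>F\<^esub>, \<zero>\<^bsub>F\<^esub>, \<zero>\<^bsub>F\<^esub>)})"

fun proj_point :: "'a::field point \<Rightarrow> ('a \<times> 'a \<times> 'a) set"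
  where
    "proj_point Infinity = proj_class ring_of_type_algebra (0, 1, 0)"
  | "proj_point (Affine x y) = proj_class ring_of_type_algebra (x, y, 1)"

text \<open>All coordinate triples of \<open>P\<close> with entries in \<open>R\<close>, at least one of them a unit, are reduced;
  they differ by units of \<open>R\<close>, so the result is a single point of the projective plane over
  the residue field.\<close>

definition reduce_point :: "('a::field \<Rightarrow> ereal) \<Rightarrow> 'a point \<Rightarrow> ('a set \<times> 'a set \<times> 'a set) set"
  where "reduce_point v P =
    {(residue v x, residue v y, residue v z) | x y z.
      (x, y, z) \<in> proj_point P \<and> {x, y, z} \<subseteq> carrier (valuation_ring v) \<and>
      (\<exists>w\<in>{x, y, z}. w \<in> Units (valuation_ring v))}"

definition reduced_curve :: "('a::field \<Rightarrow> ereal) \<Rightarrow> 'a weierstrass \<Rightarrow> 'a set weierstrass"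
  where "reduced_curve v W = map_weierstrass (residue v) W"

text \<open>The homogeneous cubic \<open>y\<^sup>2 z + a\<^sub>1 x y z + a\<^sub>3 y z\<^sup>2 - (x\<^sup>3 + a\<^sub>2 x\<^sup>2 z + a\<^sub>4 x z\<^sup>2 + a\<^sub>6 z\<^sup>3)\<close>
  and its partial derivatives with respect to \<open>x\<close>, \<open>y\<close> and \<open>z\<close>, over a ring given as a record.\<close>

fun weierstrass_form :: "('b, 'm) ring_scheme \<Rightarrow> 'b weierstrass \<Rightarrow> 'b \<times> 'b \<times> 'b \<Rightarrow> 'b"
  where "weierstrass_form F (Weierstrass a1 a2 a3 a4 a6) (x, y, z) =
    (y \<otimes>\<^bsub>F\<^esub> y \<otimes>\<^bsub>F\<^esub> z \<oplus>\<^bsub>F\<^esub> a1 \<otimes>\<^bsub>F\<^esub> x \<otimes>\<^bsub>F\<^esub> y \<otimes>\<^bsub>F\<^esub> z \<oplus>\<^bsub>F\<^esub> a3 \<otimes>\<^bsub>F\<^esub> y \<otimes>\<^bsub>F\<^esub> z \<otimes>\<^bsub>F\<^esub> z)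
    \<ominus>\<^bsub>F\<^esub> (x \<otimes>\<^bsub>F\<^esub> x \<otimes>\<^bsub>F\<^esub> x \<oplus>\<^bsub>F\<^esub> a2 \<otimes>\<^bsub>F\<^esub> x \<otimes>\<^bsub>F\<^esub> x \<otimes>\<^bsub>F\<^esub> z
       \<oplus>\<^bsub>F\<^esub> a4 \<otimes>\<^bsub>F\<^esub> x \<otimes>\<^bsub>F\<^esub> z \<otimes>\<^bsub>F\<^esub> z \<oplus>\<^bsub>F\<^esub> a6 \<otimes>\<^bsub>F\<^esub> z \<otimes>\<^bsub>F\<^esub> z \<otimes>\<^bsub>F\<^esub> z)"

fun weierstrass_form_dx :: "('b, 'm) ring_scheme \<Rightarrow> 'b weierstrass \<Rightarrow> 'b \<times> 'b \<times> 'b \<Rightarrow> 'b"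
  where "weierstrass_form_dx F (Weierstrass a1 a2 a3 a4 a6) (x, y, z) =
    a1 \<otimes>\<^bsub>F\<^esub> y \<otimes>\<^bsub>F\<^esub> z
    \<ominus>\<^bsub>F\<^esub> ([(3::nat)] \<cdot>\<^bsub>F\<^esub> (x \<otimes>\<^bsub>F\<^esub> x) \<oplus>\<^bsub>F\<^esub> [(2::nat)] \<cdot>\<^bsub>F\<^esub> (a2 \<otimes>\<^bsub>F\<^esub> x \<otimes>\<^bsub>F\<^esub> z)
       \<oplus>\<^bsub>F\<^esub> a4 \<otimes>\<^bsub>F\<^esub> z \<otimes>\<^bsub>F\<^esub> z)"

fun weierstrass_form_dy :: "('b, 'm) ring_scheme \<Rightarrow> 'b weierstrass \<Rightarrow> 'b \<times> 'b \<times> 'b \<Rightarrow> 'b"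
  where "weierstrass_form_dy F (Weierstrass a1 a2 a3 a4 a6) (x, y, z) =
    [(2::nat)] \<cdot>\<^bsub>F\<^esub> (y \<otimes>\<^bsub>F\<^esub> z) \<oplus>\<^bsub>F\<^esub> a1 \<otimes>\<^bsub>F\<^esub> x \<otimes>\<^bsub>F\<^esub> z \<oplus>\<^bsub>F\<^esub> a3 \<otimes>\<^bsub>F\<^esub> z \<otimes>\<^bsub>F\<^esub> z"

fun weierstrass_form_dz :: "('b, 'm) ring_scheme \<Rightarrow> 'b weierstrass \<Rightarrow> 'b \<times> 'b \<times> 'b \<Rightarrow> 'b"
  where "weierstrass_form_dz F (Weierstrass a1 a2 a3 a4 a6) (x, y, z) =
    (y \<otimes>\<^bsub>F\<^esub> y \<oplus>\<^bsub>F\<^esub> a1 \<otimes>\<^bsub>F\<^esub> x \<otimes>\<^bsub>F\<^esub> y \<oplus>\<^bsub>F\<^esub> [(2::nat)] \<cdot>\<^bsub>F\<^esub> (a3 \<otimes>\<^bsub>F\<^esub> y \<otimes>\<^bsub>F\<^esub> z))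
    \<ominus>\<^bsub>F\<^esub> (a2 \<otimes>\<^bsub>F\<^esub> x \<otimes>\<^bsub>F\<^esub> x \<oplus>\<^bsub>F\<^esub> [(2::nat)] \<cdot>\<^bsub>F\<^esub> (a4 \<otimes>\<^bsub>F\<^esub> x \<otimes>\<^bsub>F\<^esub> z)
       \<oplus>\<^bsub>F\<^esub> [(3::nat)] \<cdot>\<^bsub>F\<^esub> (a6 \<otimes>\<^bsub>F\<^esub> z \<otimes>\<^bsub>F\<^esub> z))"

definition singular_points :: "('b, 'm) ring_scheme \<Rightarrow> 'b weierstrass \<Rightarrow> ('b \<times> 'b \<times> 'b) set set"
  where "singular_points F W = {p \<in> proj_plane F. \<forall>q\<in>p.
    weierstrass_form F W q = \<zero>\<^bsub>F\<^esub> \<and> weierstrass_form_dx F W q = \<zero>\<^bsub>F\<^esub> \<and>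
    weierstrass_form_dy F W q = \<zero>\<^bsub>F\<^esub> \<and> weierstrass_form_dz F W q = \<zero>\<^bsub>F\<^esub>}"

end

theory Submission
  imports Defs
begin

text \<open>Reduction to the singular point gives \<open>v(y) > 0\<close>, where \<open>y\<^sup>2 = a b\<^sup>2\<close>; so it suffices to exclude
  \<open>v(a) > 0\<close>. If \<open>v(a) > 0\<close> and \<open>v(b) = 0\<close>, the denominator of
  \<open>j = - 256 a (a + 6 b)\<^sup>3 / (b\<^sup>3 (4 a + 27 b))\<close> is a unit and \<open>j\<close> is integral. If both valuations are
  positive, let \<open>c\<close> be one of \<open>a\<close>, \<open>b\<close> of least valuation: scaling by a square root of \<open>c\<close> replaces
  \<open>(a, b)\<close> by \<open>(a / c, b / c)\<close> and lowers the valuation of the discriminant by \<open>6 v(c)\<close>, so the equation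
  was not minimal.\<close>

section \<open>Behaviour of the invariants under admissible changes of coordinates\<close>

lemma b8_relation:
  assumes "b_invariants E = (b2, b4, b6, b8)"
  shows "4 * b8 = b2 * b6 - b4^2"
  using assms by (cases E) (clarsimp, simp add: algebra_simps power2_eq_square)

text \<open>\<open>b2\<close>, \<open>b4\<close>, \<open>b6\<close> are read off from
  \<open>(2y + a1 x + a3)^2 = 4x^3 + b2 x^2 + 2 b4 x + b6\<close>; completing the square absorbs
  \<open>s\<close> and \<open>t\<close>, so only the substitution in \<open>x\<close> is
  felt.\<close>

lemma b_invariants_change_equation:
  assumes "u \<noteq> 0" and "b_invariants E = (b2, b4, b6, b8)"
  shows "b_invariants (change_equation u r s t E) =
    ((b2 + 12 * r) / u^2,
     (b4 + r * b2 + 6 * r^2) / u^4,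
     (b6 + 2 * r * b4 + r^2 * b2 + 4 * r^3) / u^6,
     (b8 + 3 * r * b6 + 3 * r^2 * b4 + r^3 * b2 + 3 * r^4) / u^8)"
proof (cases E)
  case (Weierstrass a1 a2 a3 a4 a6)
  have b: "b2 = a1^2 + 4 * a2" "b4 = 2 * a4 + a1 * a3" "b6 = a3^2 + 4 * a6"
     "b8 = a1^2 * a6 + 4 * a2 * a6 - a1 * a3 * a4 + a2 * a3^2 - a4^2"
    using assms(2) Weierstrass by simp_all
  \<comment> \<open>These are the numerators of the new coefficients, so that \<open>B\<close>
    consists of polynomial identities; the powers of \<open>u\<close> are restored at the
    end.\<close>
  define A1 and A2 and A3 and A4 and A6 where
    A: "A1 = a1 + 2 * s" "A2 = a2 - s * a1 + 3 * r - s^2" "A3 = a3 + r * a1 + 2 * t"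
    "A4 = a4 - s * a3 + 2 * r * a2 - (t + r * s) * a1 + 3 * r^2 - 2 * s * t"
    "A6 = a6 + r * a4 + r^2 * a2 + r^3 - t * a3 - t^2 - r * t * a1"
  have B: "b2 + 12 * r = A1^2 + 4 * A2"
    "b4 + r * b2 + 6 * r^2 = 2 * A4 + A1 * A3"
    "b6 + 2 * r * b4 + r^2 * b2 + 4 * r^3 = A3^2 + 4 * A6"
    "b8 + 3 * r * b6 + 3 * r^2 * b4 + r^3 * b2 + 3 * r^4 =
      A1^2 * A6 + 4 * A2 * A6 - A1 * A3 * A4 + A2 * A3^2 - A4^2"
    unfolding b A by (simp_all add: algebra_simps eval_nat_numeral)
  show ?thesis
    unfolding Weierstrass change_equation.simps b_invariants.simps prod.inject B A[symmetric]
    using assms(1)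
    by (simp add: power_divide add_divide_distrib diff_divide_distrib flip: power_mult power_add)
      (simp add: algebra_simps flip: power_Suc power_add)
qed

lemma c4_change_equation:
  assumes "u \<noteq> 0"
  shows "c4_invariant (change_equation u r s t E) = c4_invariant E / u^4"
proof -
  obtain b2 b4 b6 b8 where b: "b_invariants E = (b2, b4, b6, b8)"
    by (cases "b_invariants E") auto
  have c4: "(b2 + 12 * r)^2 - 24 * (b4 + r * b2 + 6 * r^2) = b2^2 - 24 * b4"
    by (simp add: algebra_simps power2_eq_square)
  show ?thesis
    unfolding c4_invariant_def b_invariants_change_equation[OF assms b] b prod.case c4[symmetric]
    by (simp add: power_divide diff_divide_distrib flip: power_mult)
qed

lemma discriminant_change_equation:
  assumes "u \<noteq> 0"
  shows "discriminant (change_equation u r s t E) = discriminant E / u^12"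
proof -
  obtain b2 b4 b6 b8 where b: "b_invariants E = (b2, b4, b6, b8)"
    by (cases "b_invariants E") auto
  define B2 B4 B6 B8 where B: "B2 = b2 + 12 * r" "B4 = b4 + r * b2 + 6 * r^2"
    "B6 = b6 + 2 * r * b4 + r^2 * b2 + 4 * r^3"
    "B8 = b8 + 3 * r * b6 + 3 * r^2 * b4 + r^3 * b2 + 3 * r^4"
  \<comment> \<open>The last factor vanishes by \<open>4 b8 = b2 b6 - b4\<^sup>2\<close>; its cofactor is read off from the coefficient of \<open>b8\<close>.\<close>
  have "- (B2^2 * B8) - 8 * B4^3 - 27 * B6^2 + 9 * B2 * B4 * B6 =
      - (b2^2 * b8) - 8 * b4^3 - 27 * b6^2 + 9 * b2 * b4 * b6
        - (6 * r * b2 + 36 * r^2) * (4 * b8 - (b2 * b6 - b4^2))"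
    unfolding B by (simp add: algebra_simps eval_nat_numeral)
  moreover have "- ((B2 / u^2)^2 * (B8 / u^8)) - 8 * (B4 / u^4)^3 - 27 * (B6 / u^6)^2
      + 9 * (B2 / u^2) * (B4 / u^4) * (B6 / u^6) =
      (- (B2^2 * B8) - 8 * B4^3 - 27 * B6^2 + 9 * B2 * B4 * B6) / u^12"
    using assms by (simp add: power_divide diff_divide_distrib add_divide_distrib flip: power_mult power_add)
  ultimately show ?thesis
    using b8_relation[OF b]
    unfolding discriminant_def b_invariants_change_equation[OF assms b] b B[symmetric] by simp
qed

text \<open>Both \<open>c4^3\<close> and the discriminant scale by \<open>u^(-12)\<close>. This
  carries \<open>v(j) < 0\<close> from \<open>E\<close> over to \<open>W\<close>.\<close>

lemma j_invariant_change_equation: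
  assumes "u \<noteq> 0"
  shows "j_invariant (change_equation u r s t E) = j_invariant E"
  using assms unfolding j_invariant_def c4_change_equation[OF assms] discriminant_change_equation[OF assms]
  by (simp add: power_divide flip: power_mult)

lemma change_equation_scale:
  assumes "u \<noteq> 0" "w \<noteq> 0"
  shows "change_equation w 0 0 0 (change_equation u r s t E) = change_equation (u * w) r s t E"
  by (cases E) (simp add: power_mult_distrib)

text \<open>Supplies the competing equation against which minimality is tested.\<close>

lemma weierstrass_equation_of_scale:
  assumes "weierstrass_equation_of E W" "w \<noteq> 0"
  shows "weierstrass_equation_of E (change_equation w 0 0 0 W)"
  using assms change_equation_scale unfolding weierstrass_equation_of_def
  by (metis mult_eq_0_iff)

text \<open>The coefficients come from expanding \<open>x^3 + a (x - b)^2\<close>. A factor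
  \<open>16 a^2\<close> cancels between \<open>c4^3\<close> and the discriminant; the rest of the
  denominator is multiplied out.\<close>

lemma j_invariant_three_torsion_form:
  fixes a b :: "'a::field"
  assumes "discriminant (Weierstrass 0 a 0 (- 2 * a * b) (a * b^2)) \<noteq> 0"
  shows "j_invariant (Weierstrass 0 a 0 (- 2 * a * b) (a * b^2)) * (b^3 * (4 * a + 27 * b)) =
    - 256 * a * (a + 6 * b)^3"
proof -
  have D: "discriminant (Weierstrass 0 a 0 (- 2 * a * b) (a * b^2)) =
      - 16 * a^2 * (b^3 * (4 * a + 27 * b))"
    by (simp add: discriminant_def algebra_simps eval_nat_numeral)
  have c4: "c4_invariant (Weierstrass 0 a 0 (- 2 * a * b) (a * b^2)) = 16 * (a * (a + 6 * b))"
    by (simp add: c4_invariant_def algebra_simps power2_eq_square)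
  show ?thesis
    using assms unfolding j_invariant_def D c4
    by (simp add: divide_simps) (simp add: algebra_simps eval_nat_numeral)
qed

section \<open>Valuations, residues and reduction of points\<close>

context nonarch_valuation
begin

lemma v_power: "v (x ^ n) = ereal n * v x"
proof (induction n)
  case (Suc n)
  have "v (x ^ Suc n) = v x + ereal n * v x"
    by (simp add: v_mult Suc)
  also have "\<dots> = ereal (Suc n) * v x"
    using v_finite[of x] v_zero by (cases "v x") (auto simp: algebra_simps)
  finally show ?case .
qed (simp add: v_one)

lemma v_nonneg_add: "0 \<le> v x \<Longrightarrow> 0 \<le> v y \<Longrightarrow> 0 \<le> v (x + y)"
  using v_add[of x y] by (metis min.boundedI order_trans)

lemma v_nonneg_mult: "0 \<le> v x \<Longrightarrow> 0 \<le> v y \<Longrightarrow> 0 \<le> v (x * y)"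
  by (simp add: v_mult)

lemma v_nonneg_of_nat: "0 \<le> v (of_nat n)"
  by (induction n) (auto simp: v_zero v_one intro: v_nonneg_add)

lemma v_nonneg_numeral: "0 \<le> v (numeral n)"
  using v_nonneg_of_nat[of "numeral n"] by simp

lemma v_eq_minus_infinity: "v x \<noteq> - \<infinity>"
  using v_finite[of x] v_zero by (cases "x = 0") auto

lemma v_divide:
  assumes "y \<noteq> 0"
  shows "v (x / y) = v x - v y"
  using v_mult[of "x / y" y] v_finite[OF assms] v_eq_minus_infinity assms
  by (cases "v (x / y)"; cases "v x"; cases "v y") auto

lemma v_nonneg_divide:
  assumes "y \<noteq> 0" "v y \<le> v x"
  shows "0 \<le> v (x / y)"
  using v_divide[OF assms(1)] assms(2) v_finite[OF assms(1)] by (simp add: ereal_diff_positive)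

text \<open>Since \<open>y = (x + y) + (- x)\<close>, a positive valuation of \<open>x + y\<close>
  would make that of \<open>y\<close> positive.\<close>

lemma v_add_unit:
  assumes "0 < v x" "v y = 0"
  shows "v (x + y) = 0"
proof (rule antisym)
  show "v (x + y) \<le> 0"
    using v_add[of "x + y" "- x"] assms v_minus[of x] by (auto simp: min_def split: if_splits)
qed (use v_nonneg_add assms in auto)

lemma carrier_valuation_ring: "z \<in> carrier (valuation_ring v) \<longleftrightarrow> 0 \<le> v z"
  by (simp add: valuation_ring_def ring_of_type_algebra_def)

lemma valuation_ring_ops:
  "x \<oplus>\<^bsub>valuation_ring v\<^esub> y = x + y" "x \<otimes>\<^bsub>valuation_ring v\<^esub> y = x * y"
  "\<zero>\<^bsub>valuation_ring v\<^esub> = 0" "\<one>\<^bsub>valuation_ring v\<^esub> = 1"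
  by (simp_all add: valuation_ring_def ring_of_type_algebra_def)

lemma ring_hom_residue: "ring_hom_ring (valuation_ring v) (residue_field v) (residue v)"
proof -
  interpret I: maximalideal "valuation_ideal v" "valuation_ring v"
    by (rule maximalideal_valuation_ideal)
  have "residue v = (+>\<^bsub>valuation_ring v\<^esub>) (valuation_ideal v)"
    by (auto simp: residue_def)
  then show ?thesis
    using I.rcos_ring_hom_ring by (simp add: residue_field_def)
qed

lemma residue_eq_zero_iff:
  assumes "0 \<le> v z"
  shows "residue v z = \<zero>\<^bsub>residue_field v\<^esub> \<longleftrightarrow> 0 < v z"
proof -
  interpret I: maximalideal "valuation_ideal v" "valuation_ring v"
    by (rule maximalideal_valuation_ideal)
  have "residue v z = valuation_ideal v \<longleftrightarrow> z \<in> valuation_ideal v"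
    unfolding residue_def
    using I.a_rcos_const[of z] I.a_rcos_self[of z] assms carrier_valuation_ring[of z] by auto
  then show ?thesis
    by (simp add: residue_field_def FactRing_def valuation_ideal_def)
qed

lemma residue_of_nat: "residue v (of_nat n) = [n] \<cdot>\<^bsub>residue_field v\<^esub> \<one>\<^bsub>residue_field v\<^esub>"
proof -
  interpret h: ring_hom_ring "valuation_ring v" "residue_field v" "residue v"
    by (rule ring_hom_residue)
  show ?thesis
  proof (induction n)
    case 0
    then show ?case using h.hom_zero by (simp add: valuation_ring_ops)
  next
    case (Suc n)
    have "residue v (of_nat n + 1) = residue v (of_nat n) \<oplus>\<^bsub>residue_field v\<^esub> residue v 1"
      using h.hom_add[of "of_nat n" 1] v_nonneg_of_nat[of n]
      by (simp add: carrier_valuation_ring valuation_ring_ops v_one)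
    then show ?case using Suc h.hom_one by (simp add: valuation_ring_ops add.commute)
  qed
qed

text \<open>If \<open>p\<close> had positive valuation, it would kill 1 in the residue field, so the
  characteristic would divide \<open>p\<close>. It is not \<open>p\<close>, and it is not 1 because
  \<open>1 \<noteq> 0\<close> in a field.\<close>

lemma v_prime_unit:
  assumes "prime p" "ring_char (residue_field v) \<noteq> p"
  shows "v (of_nat p) = 0"
proof (rule ccontr)
  interpret F: field "residue_field v" by (rule field_residue_field)
  assume "v (of_nat p) \<noteq> 0"
  then have "0 < v (of_nat p)" using v_nonneg_of_nat[of p] by simp
  then have "[p] \<cdot>\<^bsub>residue_field v\<^esub> \<one>\<^bsub>residue_field v\<^esub> = \<zero>\<^bsub>residue_field v\<^esub>"
    using residue_eq_zero_iff residue_of_nat by (metis v_nonneg_of_nat)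
  then have "ring_char (residue_field v) dvd p"
    using F.add.pow_eq_id[of "\<one>\<^bsub>residue_field v\<^esub>" p] by (simp add: ring_char_def add_pow_def)
  then have "ring_char (residue_field v) = 1"
    using assms by (auto simp: prime_nat_iff)
  then show False
    using F.add.ord_eq_1[of "\<one>\<^bsub>residue_field v\<^esub>"] by (simp add: ring_char_def)
qed

text \<open>As \<open>a1 = a3 = 0\<close>, the partial derivative in \<open>y\<close> at
  \<open>(x, y, 1)\<close> is \<open>2 y\<close>, and 2 is a unit.\<close>

lemma reduces_to_singular_imp:
  fixes a2 a4 a6 x y :: 'a
  assumes "0 \<le> v x" "0 \<le> v y" "v 2 = 0"
    and sing: "reduce_point v (Affine x y) \<in>
           singular_points (residue_field v) (reduced_curve v (Weierstrass 0 a2 0 a4 a6))"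
  shows "0 < v y"
proof -
  interpret h: ring_hom_ring "valuation_ring v" "residue_field v" "residue v"
    by (rule ring_hom_residue)
  let ?F = "residue_field v" let ?r = "residue v"
  have c: "x \<in> carrier (valuation_ring v)" "y \<in> carrier (valuation_ring v)"
    "0 \<in> carrier (valuation_ring v)" "1 \<in> carrier (valuation_ring v)"
    using assms by (auto simp: carrier_valuation_ring v_zero v_one)
  have r01: "?r 0 = \<zero>\<^bsub>?F\<^esub>" "?r 1 = \<one>\<^bsub>?F\<^esub>"
    using h.hom_zero h.hom_one by (simp_all add: valuation_ring_ops)
  \<comment> \<open>This triple is already normalised for reduction: its entries are integral and
    the last is a unit.\<close>
  have "(x, y, 1) \<in> proj_point (Affine x y)"
    by (auto simp: ring_of_type_algebra_def intro!: image_eqI[of _ _ 1])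
  moreover have "1 \<in> Units (valuation_ring v)"
    using h.R.Units_one_closed by (simp add: valuation_ring_ops)
  ultimately have "(?r x, ?r y, ?r 1) \<in> reduce_point v (Affine x y)"
    using c unfolding reduce_point_def by blast
  then have "weierstrass_form_dy ?F (reduced_curve v (Weierstrass 0 a2 0 a4 a6))
      (?r x, ?r y, ?r 1) = \<zero>\<^bsub>?F\<^esub>"
    using sing unfolding singular_points_def by blast
  then have "?r y \<oplus>\<^bsub>?F\<^esub> ?r y = \<zero>\<^bsub>?F\<^esub>"
    using c h.hom_closed[of x] h.hom_closed[of y]
    by (simp add: reduced_curve_def r01 numeral_2_eq_2)
  then have "?r (y + y) = \<zero>\<^bsub>?F\<^esub>"
    using c h.hom_add[of y y] by (simp add: valuation_ring_ops)
  then have "0 < v (2 * y)"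
    unfolding mult_2 using residue_eq_zero_iff v_nonneg_add assms(2) by blast
  then show ?thesis using assms(3) by (simp add: v_mult)
qed

end

section \<open>Minimality and the exclusion of \<open>v(a) > 0\<close>\<close>

lemma not_minimal_model_three_torsion_form:
  fixes v :: "'a::alg_closed_field \<Rightarrow> ereal"
  assumes "nonarch_valuation v" "minimal_model v E (Weierstrass 0 a 0 (- 2 * a * b) (a * b^2))"
    and D: "discriminant (Weierstrass 0 a 0 (- 2 * a * b) (a * b^2)) \<noteq> 0"
    and "0 < v a" "0 < v b"
  shows False
proof -
  interpret nonarch_valuation v by fact
  let ?W = "Weierstrass 0 a 0 (- 2 * a * b) (a * b^2)"
  have "a \<noteq> 0" "b \<noteq> 0" using D by (auto simp: discriminant_def)
  then obtain c where c: "c \<noteq> 0" "v c \<le> v a" "v c \<le> v b" "0 < v c"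
    using assms(4,5) by (metis linear)
  \<comment> \<open>Algebraic closedness of \<open>K\<close> provides the root; scaling by
    \<open>w\<close> divides \<open>a2\<close>, \<open>a4\<close>, \<open>a6\<close> by
    \<open>c\<close>, \<open>c^2\<close>, \<open>c^3\<close>.\<close>
  obtain w where w: "w^2 = c" using nth_root_exists[of 2 c] by auto
  then have "w \<noteq> 0" using c by auto
  define a' b' where ab': "a' = a / c" "b' = b / c"
  have pos: "0 \<le> v a'" "0 \<le> v b'" using c v_nonneg_divide by (auto simp: ab')
  have pw: "w^4 = c^2" "w^6 = c^3"
    unfolding w[symmetric] by (simp_all flip: power_mult)
  have W': "change_equation w 0 0 0 ?W = Weierstrass 0 a' 0 (- 2 * a' * b') (a' * b'^2)"
    unfolding change_equation.simps w pw ab'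
    using c by (simp add: power2_eq_square power3_eq_cube)
  have "0 \<le> v (a' * b'^2)" "0 \<le> v (- 2 * a' * b')"
    using pos v_nonneg_mult v_nonneg_numeral v_minus[of "2 * a' * b'"]
    by (simp_all add: power2_eq_square)
  then have "integral_equation v (change_equation w 0 0 0 ?W)"
    unfolding W' integral_equation_def using pos by (auto simp: carrier_valuation_ring v_zero)
  moreover have "weierstrass_equation_of E (change_equation w 0 0 0 ?W)"
    using assms(2) \<open>w \<noteq> 0\<close> unfolding minimal_model_def
    by (blast intro: weierstrass_equation_of_scale)
  ultimately have "v (discriminant ?W) \<le> v (discriminant ?W / w^12)"
    using assms(2) discriminant_change_equation[OF \<open>w \<noteq> 0\<close>] unfolding minimal_model_def by metis
  moreover have "w^12 = c^6" unfolding w[symmetric] by (simp flip: power_mult)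
  ultimately have "v (discriminant ?W) \<le> v (discriminant ?W) - 6 * v c"
    using v_divide[of "c^6"] c v_power[of c 6] by simp
  \<comment> \<open>Both valuations are finite and \<open>v c\<close> is positive, so the inequality
    cannot hold.\<close>
  then show False
    using v_finite[OF D] v_finite[OF c(1)] c(4)
    by (cases "v (discriminant ?W)"; cases "v c") auto
qed

theorem lemma4p2:
  fixes v :: "'a::alg_closed_field \<Rightarrow> ereal"
    and E W :: "'a weierstrass"
    and P :: "'a point"
    and u r s t a b :: 'a
  assumes "nonarch_valuation v"
    and "ring_char (residue_field v) \<noteq> 2" and "ring_char (residue_field v) \<noteq> 3"
    and "elliptic_curve E" and "v (j_invariant E) < 0"
    and "minimal_model v E W"
    and "u \<noteq> 0" and "W = change_equation u r s t E"
    and "a \<in> carrier (valuation_ring v)" and "b \<in> carrier (valuation_ring v)"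
    and "W = Weierstrass 0 a 0 (- 2 * a * b) (a * b^2)"
    and "P \<in> torsion E 3"
    and "reduce_point v (change_point u r s t P) \<in>
           singular_points (residue_field v) (reduced_curve v W)"
    and "\<exists>y. change_point u r s t P = Affine 0 y"
  shows "v a = 0 \<and> v b > 0"
proof -
  interpret nonarch_valuation v by fact
  note W = \<open>W = Weierstrass 0 a 0 (- 2 * a * b) (a * b^2)\<close>
  have va: "0 \<le> v a" and vb: "0 \<le> v b"
    using assms(9,10) by (simp_all add: carrier_valuation_ring)
  have v2: "v 2 = 0" and v3: "v 3 = 0"
    using v_prime_unit[of 2] v_prime_unit[of 3] assms(2,3) by auto
  have D: "discriminant W \<noteq> 0"
    using assms(4,7,8) discriminant_change_equation[of u r s t E] by (simp add: elliptic_curve_def)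
  have j: "j_invariant W = j_invariant E"
    using assms(7,8) j_invariant_change_equation[of u r s t E] by simp
  obtain y where y: "change_point u r s t P = Affine 0 y" using assms(14) by auto
  have "on_curve W (Affine 0 y)"
    using on_curve_change_point[OF assms(7), of r s t E P] assms(8,12) y by (simp add: torsion_def)
  then have "y^2 = a * b^2" by (simp add: W)
  then have vy: "2 * v y = v a + 2 * v b"
    using v_power[of y 2] v_power[of b 2] v_mult[of a "b^2"] by simp
  \<comment> \<open>Integrality of \<open>y\<close> lets the affine coordinates be reduced without
    rescaling.\<close>
  have "0 \<le> v y"
    using vy va vb v_eq_minus_infinity[of y] by (cases "v y"; cases "v a"; cases "v b") auto
  then have vy_pos: "0 < v y"
    using reduces_to_singular_imp[OF _ _ v2 assms(13)[unfolded y W]] v_zero by simp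
  have va0: "v a = 0"
  proof (rule ccontr)
    assume "v a \<noteq> 0"
    then have a: "0 < v a" using va by simp
    have vb0: "v b = 0"
      using not_minimal_model_three_torsion_form[of v E a b] a vb assms(1,6) D
      unfolding W by (metis order_le_less)
    \<comment> \<open>In \<open>4 a + 27 b\<close> the second term is a unit, because the residue
      characteristic is not 3, and the first is not; hence the sum is a unit.\<close>
    have "v (3^3 * b) = 0" "0 < v (4 * a)"
      using vb0 v3 v_power[of 3 3] a v_nonneg_numeral[of "num.Bit0 (num.Bit0 num.One)"]
      by (auto simp: v_mult add_nonneg_pos)
    then have den: "v (b^3 * (4 * a + 27 * b)) = 0"
      using v_add_unit[of "4 * a" "27 * b"] vb0 by (simp add: v_mult v_power)
    have "v (j_invariant W) = v (- 256 * a * (a + 6 * b)^3)"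
      using j_invariant_three_torsion_form[of a b] D den v_mult[of "j_invariant W"]
      unfolding W by (metis add.right_neutral)
    also have "\<dots> = v (256 * (a * (a + 6 * b)^3))"
      using v_minus[of "256 * (a * (a + 6 * b)^3)"] by (simp add: mult.assoc)
    also have "\<dots> \<ge> 0"
      using va vb by (simp add: power3_eq_cube v_nonneg_mult v_nonneg_add v_nonneg_numeral)
    finally show False using j assms(5) by simp
  qed
  \<comment> \<open>With \<open>v a = 0\<close>, the relation \<open>vy\<close> reads
    \<open>v y = v b\<close>.\<close>
  moreover have "0 < v b"
    using vy va0 vy_pos vb by (cases "v b = 0") auto
  ultimately show ?thesis by simp
qed

end
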